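(* Let $\mathcal{A}\in\mathbb{C}^{n_1\times n_2\times n_3}$ and $\mathcal{G}\in\mathbb{C}^{n_2\times n_1\times n_3}$. If $\mathcal{A}$ is invertible along $\mathcal{G}$, then $$\mathcal{A}^{\parallel\mathcal{G}}=\mathcal{G}*_c(\mathcal{G}*_c\mathcal{A}*_c\mathcal{G})^\dagger*_c\mathcal{G}.$$
   Context: For a third-order tensor $\mathcal{A}\in\mathbb{C}^{n_1\times n_2\times n_3}$, $\mathcal{A}^{(i)}=\mathcal{A}(:,:,i)\in\mathbb{C}^{n_1\times n_2}$ denotes its $i$-th frontal slice. Let $\mathbf{C}_{n_3}$ be the $n_3\times n_3$ orthogonal DCT matrix, with entries $(\mathbf{C}_{n_3})_{jk}=\sqrt{(2-\delta_{j1})/n_3}\,\cos\big(\tfrac{(j-1)(2k-1)\pi}{2n_3}\big)$; let $\mathbf{W}$ be the diagonal matrix whose diagonal is the first column of $\mathbf{C}_{n_3}$; let $\mathbf{Z}$ be the $n_3\times n_3$ matrix with ones on the first superdiagonal and zeros elsewhere; and put $\mathbf{M}=\mathbf{W}^{-1}\mathbf{C}_{n_3}(\mathbf{I}+\mathbf{Z})$, an invertible matrix. Define the linear bijection $L$ on tensors with third dimension $n_3$ by $L(\mathcal{A})_{ijk}=\sum_{l=1}^{n_3}\mathbf{M}_{kl}\mathcal{A}_{ijl}$. The C-product of $\mathcal{A}\in\mathbb{C}^{n_1\times n_2\times n_3}$ and $\mathcal{B}\in\mathbb{C}^{n_2\times l\times n_3}$ is the tensor $\mathcal{A}*_c\mathcal{B}\in\mathbb{C}^{n_1\times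 l\times n_3}$ determined by $L(\mathcal{A}*_c\mathcal{B})^{(i)}=L(\mathcal{A})^{(i)}L(\mathcal{B})^{(i)}$, $i=1,\dots,n_3$. The conjugate transpose $\mathcal{A}^H$ is determined by $L(\mathcal{A}^H)^{(i)}=(L(\mathcal{A})^{(i)})^H$ for all $i$. The Moore-Penrose inverse $\mathcal{B}^\dagger$ is the (unique) tensor $\mathcal{X}$ with $\mathcal{B}*_c\mathcal{X}*_c\mathcal{B}=\mathcal{B}$, $\mathcal{X}*_c\mathcal{B}*_c\mathcal{X}=\mathcal{X}$, $(\mathcal{B}*_c\mathcal{X})^H=\mathcal{B}*_c\mathcal{X}$, $(\mathcal{X}*_c\mathcal{B})^H=\mathcal{X}*_c\mathcal{B}$. Let $\mathcal{A}\in\mathbb{C}^{n_1\times n_2\times n_3}$ and $\mathcal{G}\in\mathbb{C}^{n_2\times n_1\times n_3}$. $\mathcal{A}$ is invertible along $\mathcal{G}$ if there exist $\mathcal{X}\in\mathbb{C}^{n_2\times n_1\times n_3}$, $\mathcal{U}\in\mathbb{C}^{n_1\times n_1\times n_3}$ and $\mathcal{V}\in\mathbb{C}^{n_2\times n_2\times n_3}$ such that $\mathcal{X}*_c\mathcal{A}*_c\mathcal{G}=\mathcal{G}$, $\mathcal{G}*_c\mathcal{A}*_c\mathcal{X}=\mathcal{G}$, $\mathcal{X}=\mathcal{G}*_c\mathcal{U}$ and $\mathcal{X}^H=\mathcal{G}^H*_c\mathcal{V}$; such an $\mathcal{X}$ is unique, is called the inverse of $\mathcal{A}$ along $\mathcal{G}$,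 and is denoted $\mathcal{A}^{\parallel\mathcal{G}}$. *)

theory Defs
  imports Complex_Main
    "Jordan_Normal_Form.Matrix"
    "Jordan_Normal_Form.Gauss_Jordan_Elimination"
    "Jordan_Normal_Form.Schur_Decomposition"
begin

text \<open>
  A third-order complex tensor is the vector of its frontal slices. All indices start at \<open>0\<close>,
  so \<open>T $ k\<close> is the \<open>(k + 1)\<close>-st frontal slice in the usual one-based numbering.
\<close>

type_synonym tensor = "complex mat vec"

definition carrier_tensor :: "nat \<Rightarrow> nat \<Rightarrow> nat \<Rightarrow> tensor set" where
  "carrier_tensor n1 n2 n3 = {T. dim_vec T = n3 \<and> (\<forall>k<n3. T $ k \<in> carrier_mat n1 n2)}"

text \<open>
  All slices of an element of \<open>carrier_tensor n1 n2 n3\<close> have the same shape, so the first two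
  dimensions can be read off the first slice. If \<open>n3 = 0\<close> these two values are meaningless, but
  then \<open>carrier_tensor\<close> does not depend on them either.
\<close>

definition dim1 :: "tensor \<Rightarrow> nat" where
  "dim1 T = dim_row (T $ 0)"

definition dim2 :: "tensor \<Rightarrow> nat" where
  "dim2 T = dim_col (T $ 0)"

definition dim3 :: "tensor \<Rightarrow> nat" where
  "dim3 T = dim_vec T"

text \<open>
  The orthogonal DCT matrix; with zero-based \<open>j\<close> and \<open>k\<close> the factor \<open>(j - 1) (2 k - 1)\<close> of the
  one-based formula becomes \<open>j (2 k + 1)\<close>.
\<close>

definition dct_mat :: "nat \<Rightarrow> complex mat" where
  "dct_mat n = mat n n (\<lambda>(j, k). complex_of_real
     (sqrt ((2 - (if j = 0 then 1 else 0)) / real n)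
      * cos (real j * (2 * real k + 1) * pi / (2 * real n))))"

definition W_mat :: "nat \<Rightarrow> complex mat" where
  "W_mat n = mat_diag n (\<lambda>j. col (dct_mat n) 0 $ j)"

definition Z_mat :: "nat \<Rightarrow> complex mat" where
  "Z_mat n = mat n n (\<lambda>(j, k). if k = j + 1 then 1 else 0)"

text \<open>
  \<open>W_mat n\<close> is invertible, since \<open>cos (j \<pi> / (2 n)) > 0\<close> for \<open>j < n\<close>; hence \<open>the\<close> is applied
  to a proper value.
\<close>

definition M_mat :: "nat \<Rightarrow> complex mat" where
  "M_mat n = the (mat_inverse (W_mat n)) * dct_mat n * (1\<^sub>m n + Z_mat n)"

definition L :: "tensor \<Rightarrow> tensor" where
  "L T = vec (dim3 T) (\<lambda>k. mat (dim1 T) (dim2 T)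
     (\<lambda>(i, j). \<Sum>l<dim3 T. M_mat (dim3 T) $$ (k, l) * (T $ l) $$ (i, j)))"

text \<open>
  The definite descriptions in \<open>cprod\<close> and \<open>ctranspose\<close> denote properly because \<open>L\<close> is a
  bijection of each \<open>carrier_tensor n1 n2 n3\<close> onto itself.
\<close>

definition cprod :: "tensor \<Rightarrow> tensor \<Rightarrow> tensor" (infixl \<open>*\<^sub>c\<close> 70) where
  "A *\<^sub>c B = (THE T. T \<in> carrier_tensor (dim1 A) (dim2 B) (dim3 A) \<and>
     (\<forall>k<dim3 A. L T $ k = L A $ k * L B $ k))"

definition ctranspose :: "tensor \<Rightarrow> tensor" (\<open>_\<^sup>H\<close> [1000] 999) where
  "A\<^sup>H = (THE T. T \<in> carrier_tensor (dim2 A) (dim1 A) (dim3 A) \<and>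
     (\<forall>k<dim3 A. L T $ k = mat_adjoint (L A $ k)))"

definition is_mp_inverse :: "tensor \<Rightarrow> tensor \<Rightarrow> bool" where
  "is_mp_inverse B X \<longleftrightarrow>
     X \<in> carrier_tensor (dim2 B) (dim1 B) (dim3 B) \<and>
     B *\<^sub>c X *\<^sub>c B = B \<and> X *\<^sub>c B *\<^sub>c X = X \<and>
     (B *\<^sub>c X)\<^sup>H = B *\<^sub>c X \<and> (X *\<^sub>c B)\<^sup>H = X *\<^sub>c B"

definition mp_inverse :: "tensor \<Rightarrow> tensor" (\<open>_\<^sup>\<dagger>\<close> [1000] 999) where
  "B\<^sup>\<dagger> = (THE X. is_mp_inverse B X)"

definition is_inverse_along :: "tensor \<Rightarrow> tensor \<Rightarrow> tensor \<Rightarrow> bool" where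
  "is_inverse_along A G X \<longleftrightarrow>
     X \<in> carrier_tensor (dim2 A) (dim1 A) (dim3 A) \<and>
     (\<exists>U \<in> carrier_tensor (dim1 A) (dim1 A) (dim3 A).
      \<exists>V \<in> carrier_tensor (dim2 A) (dim2 A) (dim3 A).
        X *\<^sub>c A *\<^sub>c G = G \<and> G *\<^sub>c A *\<^sub>c X = G \<and> X = G *\<^sub>c U \<and> X\<^sup>H = G\<^sup>H *\<^sub>c V)"

definition invertible_along :: "tensor \<Rightarrow> tensor \<Rightarrow> bool" where
  "invertible_along A G \<longleftrightarrow> (\<exists>X. is_inverse_along A G X)"

definition inverse_along :: "tensor \<Rightarrow> tensor \<Rightarrow> tensor" (infix \<open>\<parallel>\<^sub>c\<close> 75) where
  "A \<parallel>\<^sub>c G = (THE X. is_inverse_along A G X)"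

end

theory Submission
  imports Defs
begin

text \<open>
  Write \<open>B = G *\<^sub>c A *\<^sub>c G\<close>. An inverse \<open>X\<close> of \<open>A\<close> along \<open>G\<close> is both a right multiple \<open>G *\<^sub>c U\<close>
  and, after taking the conjugate transpose of the condition on \<open>X\<^sup>H\<close>, a left multiple
  \<open>V *\<^sub>c G\<close> of \<open>G\<close>. Substituting these forms into \<open>X *\<^sub>c A *\<^sub>c G = G = G *\<^sub>c A *\<^sub>c X\<close> gives
  \<open>V *\<^sub>c B = G = B *\<^sub>c U\<close>. Hence, for every \<open>P\<close> with \<open>B *\<^sub>c P *\<^sub>c B = B\<close>,
  \<open>G *\<^sub>c P *\<^sub>c G = V *\<^sub>c B *\<^sub>c P *\<^sub>c B *\<^sub>c U = V *\<^sub>c B *\<^sub>c U = G *\<^sub>c U = X\<close>,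
  and \<open>P = B\<^sup>\<dagger>\<close> is such a tensor.

  What remains is that the descriptions behind the operations denote. For \<open>A \<parallel>\<^sub>c G\<close> this is
  \<open>inverse_along_unique\<close>, again a consequence of the two multiples. For \<open>*\<^sub>c\<close> and \<open>\<^sup>H\<close> it is the
  bijectivity of \<open>L\<close> (\<open>bij_betw_L\<close>): \<open>L\<close> acts along the third mode by \<open>M_mat\<close>, a product of an
  invertible diagonal, an orthogonal (\<open>dct_mat_orthogonal\<close>) and a unitriangular matrix. Through \<open>L\<close>
  every tensor identity becomes a family of matrix identities, one for each slice, so \<open>B\<^sup>\<dagger>\<close> is
  well defined because every complex matrix has exactly one Moore-Penrose inverse
  (\<open>exists_mat_mp_inverse\<close>, \<open>mat_mp_inverse_unique\<close>). Its existence follows from Gaussian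
  elimination and the normal equations.
\<close>

section \<open>Matrices and their adjoints\<close>

lemma mat_mult_assoc:
  fixes A B C :: "'a :: semiring_0 mat"
  assumes "dim_col A = dim_row B" "dim_col B = dim_row C"
  shows "A * B * C = A * (B * C)"
  using assms by (intro assoc_mult_mat[of _ "dim_row A" "dim_row B" _ "dim_row C" _ "dim_col C"]) auto

lemma dim_row_mat_adjoint [simp]: "dim_row (mat_adjoint A) = dim_col A"
  and dim_col_mat_adjoint [simp]: "dim_col (mat_adjoint A) = dim_row A"
  by (auto simp: mat_adjoint_def)

lemma index_mat_adjoint [simp]:
  assumes "i < dim_col A" "j < dim_row A"
  shows "mat_adjoint A $$ (i, j) = conjugate (A $$ (j, i))"
  using assms by (simp add: mat_adjoint_def mat_of_rows_index)

lemma mat_adjoint_carrier [simp, intro]: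
  "A \<in> carrier_mat n m \<Longrightarrow> mat_adjoint A \<in> carrier_mat m n"
  by auto

lemma mat_adjoint_adjoint [simp]: "mat_adjoint (mat_adjoint A) = A"
  by (rule eq_matI) auto

lemma mat_adjoint_mult:
  fixes A B :: "complex mat"
  assumes "dim_col A = dim_row B"
  shows "mat_adjoint (A * B) = mat_adjoint B * mat_adjoint A"
  using assms by (intro eq_matI) (auto simp: scalar_prod_def mult.commute)

text \<open>
  The \<open>j\<close>-th diagonal entry of \<open>mat_adjoint D * D\<close> is the squared Euclidean norm of column \<open>j\<close>
  of \<open>D\<close>.
\<close>

lemma mat_adjoint_mult_eq_0_imp:
  fixes D :: "complex mat"
  assumes "mat_adjoint D * D = 0\<^sub>m (dim_col D) (dim_col D)"
  shows "D = 0\<^sub>m (dim_row D) (dim_col D)"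
proof (rule eq_matI)
  fix i j assume ij: "i < dim_row (0\<^sub>m (dim_row D) (dim_col D) :: complex mat)"
    "j < dim_col (0\<^sub>m (dim_row D) (dim_col D) :: complex mat)"
  have "(mat_adjoint D * D) $$ (j, j) = (\<Sum>k<dim_row D. complex_of_real ((cmod (D $$ (k, j)))\<^sup>2))"
    using ij by (auto simp: scalar_prod_def atLeast0LessThan mult.commute complex_norm_square
        simp del: of_real_power intro!: sum.cong)
  hence "complex_of_real (\<Sum>k<dim_row D. (cmod (D $$ (k, j)))\<^sup>2) = 0"
    using assms ij by simp
  hence "(\<Sum>k<dim_row D. (cmod (D $$ (k, j)))\<^sup>2) = 0"
    unfolding of_real_eq_0_iff .
  thus "D $$ (i, j) = 0\<^sub>m (dim_row D) (dim_col D) $$ (i, j)"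
    using ij by (simp add: sum_nonneg_eq_0_iff)
qed auto

section \<open>Moore-Penrose inverses of complex matrices\<close>

text \<open>
  Row reduction gives \<open>B = Q * E\<close> with \<open>Q\<close> invertible, so an inner inverse of \<open>B\<close> comes from one
  of its reduced row echelon form \<open>E\<close>. For \<open>E\<close> the matrix \<open>K\<close> that sends the \<open>i\<close>-th unit vector to
  the unit vector of the pivot column of row \<open>i\<close> works: \<open>E * K\<close> is the projection onto the nonzero
  rows. The pivot function takes the value \<open>nc\<close> on zero rows, and then column \<open>i\<close> of \<open>K\<close> is zero.
\<close>

lemma exists_inner_inverse:
  fixes B :: "'a :: field mat"
  assumes B: "B \<in> carrier_mat nr nc"
  obtains Y where "Y \<in> carrier_mat nc nr" "B * Y * B = B"
proof -
  define E where "E = gauss_jordan_single B"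
  note gj = gauss_jordan_single[OF B E_def[symmetric]]
  obtain P Q where E: "E = P * B" and P: "P \<in> carrier_mat nr nr" and Q: "Q \<in> carrier_mat nr nr"
    and QP: "Q * P = 1\<^sub>m nr"
    using gj(4) by auto
  obtain f where f: "pivot_fun E f nc"
    using gj(2,3) by (auto simp: row_echelon_form_def)
  have [simp]: "dim_row E = nr" "dim_col E = nc"
    using gj(2) by auto
  note piv = pivot_funD[OF \<open>dim_row E = nr\<close> f]
  define K where "K = mat nc nr (\<lambda>(j, i). if j = f i then 1 else (0 :: 'a))"
  have K: "K \<in> carrier_mat nc nr" by (simp add: K_def)
  have EK: "(E * K) $$ (i, i') = (if i = i' \<and> f i < nc then 1 else 0)" if "i < nr" "i' < nr" for i i'
  proof -
    have "(E * K) $$ (i, i') = (\<Sum>j<nc. E $$ (i, j) * (if j = f i' then 1 else 0))"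
      using that by (simp add: K_def scalar_prod_def atLeast0LessThan)
    also have "\<dots> = (\<Sum>j<nc. if j = f i' then E $$ (i, j) else 0)"
      by (intro sum.cong) auto
    also have "\<dots> = (if f i' < nc then E $$ (i, f i') else 0)"
      by simp
    finally show ?thesis using piv(4)[of i] piv(5)[of i' i] that by auto
  qed
  have EKE: "E * K * E = E"
  proof (rule eq_matI)
    fix i j assume "i < dim_row E" "j < dim_col E"
    hence ij: "i < nr" "j < nc" by auto
    have "(E * K * E) $$ (i, j) = (\<Sum>i'<nr. (E * K) $$ (i, i') * E $$ (i', j))"
      using ij K by (subst index_mult_mat) (auto simp: scalar_prod_def atLeast0LessThan
          simp del: index_mult_mat(1) intro!: sum.cong)
    also have "\<dots> = (\<Sum>i'<nr. if i' = i then (if f i < nc then E $$ (i, j) else 0) else 0)"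
      using ij by (intro sum.cong) (auto simp: EK simp del: index_mult_mat(1))
    also have "\<dots> = (if f i < nc then E $$ (i, j) else 0)"
      using ij by simp
    also have "\<dots> = E $$ (i, j)"
      using piv(1)[of i] piv(2)[of i j] ij by auto
    finally show "(E * K * E) $$ (i, j) = E $$ (i, j)" .
  qed (use K in auto)
  have BQE: "B = Q * E"
    using B P Q by (simp add: E QP flip: assoc_mult_mat[OF Q P B])
  have "B * (K * P) * B = Q * (E * K * E)"
    using B P Q K by (subst (1) BQE) (simp add: E mat_mult_assoc)
  with BQE have "B * (K * P) * B = B" by (simp add: EKE)
  thus ?thesis by (rule that[OF mult_carrier_mat[OF K P]])
qed

text \<open>
  With any inner inverse \<open>S\<close> of the Gram matrix \<open>mat_adjoint B * B\<close>, the matrix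
  \<open>Y = S * mat_adjoint B\<close> solves the normal equations of the least-squares problem for \<open>B\<close>,
  which makes \<open>B * Y\<close> the orthogonal projection onto the range of \<open>B\<close>.
\<close>

lemma exists_least_squares_inverse:
  fixes B :: "complex mat"
  assumes B: "B \<in> carrier_mat nr nc"
  obtains Y where "Y \<in> carrier_mat nc nr" "B * Y * B = B" "mat_adjoint (B * Y) = B * Y"
proof -
  let ?B = "mat_adjoint B"
  have Bc: "?B \<in> carrier_mat nc nr" using B by auto
  have "?B * B \<in> carrier_mat nc nc" using B by auto
  then obtain S where S: "S \<in> carrier_mat nc nc" and inner: "?B * B * S * (?B * B) = ?B * B"
    using exists_inner_inverse by blast
  define Y where "Y = S * ?B"
  have Y: "Y \<in> carrier_mat nc nr" unfolding Y_def by (rule mult_carrier_mat[OF S Bc])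
  have [simp]: "dim_row B = nr" "dim_col B = nc" "dim_row S = nc" "dim_col S = nc"
    using B S by auto
  \<comment> \<open>The residual \<open>D\<close> has columns in the range of \<open>B\<close> and, by \<open>BD\<close>, orthogonal to that range.\<close>
  define D where "D = B * Y * B - B"
  have D: "D \<in> carrier_mat nr nc" unfolding D_def by (rule minus_carrier_mat[OF B])
  have BD: "?B * D = 0\<^sub>m nc nc"
  proof -
    have "?B * D = ?B * (B * Y * B) - ?B * B"
      unfolding D_def using B Y by (intro mult_minus_distrib_mat[of _ nc nr _ nc]) auto
    also have "?B * (B * Y * B) = ?B * B"
      using inner by (simp add: Y_def mat_mult_assoc)
    also have "?B * B - ?B * B = 0\<^sub>m nc nc"
      by (rule eq_matI) auto
    finally show ?thesis .
  qed
  have "D = B * (Y * B - 1\<^sub>m nc)"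
    using B Y by (simp add: D_def mult_minus_distrib_mat[of _ nr nc _ nc] assoc_mult_mat[of _ nr nc _ nr _ nc])
  hence "mat_adjoint D = mat_adjoint (Y * B - 1\<^sub>m nc) * ?B"
    using B Y by (simp add: mat_adjoint_mult)
  hence "mat_adjoint D * D = mat_adjoint (Y * B - 1\<^sub>m nc) * (?B * D)"
    using B Y D by (simp add: mat_mult_assoc)
  also have "\<dots> = 0\<^sub>m nc nc"
    using B Y by (simp add: BD)
  finally have D0: "D = 0\<^sub>m nr nc"
    using mat_adjoint_mult_eq_0_imp[of D] D by simp
  hence BYB: "B * Y * B = B"
  proof -
    have "B * Y * B = (B * Y * B - B) + B"
      using B Y by (intro eq_matI) auto
    thus ?thesis using D0 B unfolding D_def by simp
  qed
  have adj: "mat_adjoint (B * Y) = B * mat_adjoint S * ?B"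
    by (simp add: Y_def mat_adjoint_mult mat_mult_assoc)
  \<comment> \<open>Inserting \<open>B = B * Y * B\<close> in the factor \<open>mat_adjoint B\<close> of \<open>Y\<close> makes \<open>B * Y * B\<close> appear once more.\<close>
  have "B * Y = B * S * mat_adjoint (B * Y * B)"
    unfolding BYB by (simp add: Y_def mat_mult_assoc)
  also have "\<dots> = B * Y * B * mat_adjoint S * ?B"
    by (simp add: Y_def mat_adjoint_mult mat_mult_assoc)
  also have "\<dots> = mat_adjoint (B * Y)"
    unfolding BYB adj ..
  finally show ?thesis using that[OF Y BYB] by simp
qed

definition is_mat_mp_inverse :: "complex mat \<Rightarrow> complex mat \<Rightarrow> bool" where
  "is_mat_mp_inverse B X \<longleftrightarrow>
     X \<in> carrier_mat (dim_col B) (dim_row B) \<and> B * X * B = B \<and> X * B * X = X \<and>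
     mat_adjoint (B * X) = B * X \<and> mat_adjoint (X * B) = X * B"

text \<open>
  Least-squares inverses \<open>Y\<close> of \<open>B\<close> and \<open>mat_adjoint Z\<close> of \<open>mat_adjoint B\<close> make \<open>B * Y\<close> and
  \<open>Z * B\<close> Hermitian. The product \<open>X = Z * B * Y\<close> inherits both properties, since
  \<open>B * X = B * Y\<close> and \<open>X * B = Z * B\<close>.
\<close>

lemma exists_mat_mp_inverse:
  fixes B :: "complex mat"
  obtains X where "is_mat_mp_inverse B X"
proof -
  define nr nc where "nr = dim_row B" and "nc = dim_col B"
  have B: "B \<in> carrier_mat nr nc" by (auto simp: nr_def nc_def)
  obtain Y where Y: "Y \<in> carrier_mat nc nr" "B * Y * B = B" "mat_adjoint (B * Y) = B * Y"
    using exists_least_squares_inverse[OF B] .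
  obtain Z' where Z': "Z' \<in> carrier_mat nr nc" "mat_adjoint B * Z' * mat_adjoint B = mat_adjoint B"
      "mat_adjoint (mat_adjoint B * Z') = mat_adjoint B * Z'"
    using exists_least_squares_inverse[of "mat_adjoint B" nc nr] B by auto
  define Z where "Z = mat_adjoint Z'"
  have [simp]: "dim_row B = nr" "dim_col B = nc" "dim_row Y = nc" "dim_col Y = nr"
    "dim_row Z = nc" "dim_col Z = nr" "dim_row Z' = nr" "dim_col Z' = nc"
    using B Y(1) Z'(1) by (auto simp: Z_def)
  have BZB: "B * Z * B = B"
    using arg_cong[OF Z'(2), of mat_adjoint] by (simp add: Z_def mat_adjoint_mult mat_mult_assoc)
  have ZB: "mat_adjoint (Z * B) = Z * B"
    using arg_cong[OF Z'(3), of mat_adjoint] by (simp add: Z_def mat_adjoint_mult)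
  define X where "X = Z * B * Y"
  have BX: "B * X = B * Y"
    using BZB by (simp add: X_def flip: mat_mult_assoc)
  have XB: "X * B = Z * B"
    using Y(2) by (simp add: X_def mat_mult_assoc)
  have "X * B * X = Z * (B * X)"
    unfolding XB by (simp add: X_def mat_mult_assoc)
  also have "\<dots> = X"
    unfolding BX by (simp add: X_def mat_mult_assoc)
  finally have "X * B * X = X" .
  moreover have "X \<in> carrier_mat nc nr" by (rule carrier_matI) (simp_all add: X_def)
  ultimately have "is_mat_mp_inverse B X"
    using Y ZB by (simp add: is_mat_mp_inverse_def BX XB)
  thus ?thesis by (rule that)
qed

text \<open>
  \<open>B * X\<close> and \<open>B * X'\<close> are Hermitian idempotents with the same range, hence equal, and likewise
  \<open>X * B\<close> and \<open>X' * B\<close>; and \<open>X\<close> is recovered from these products as \<open>X * B * X\<close>.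
\<close>

lemma mat_mp_inverse_unique:
  assumes X: "is_mat_mp_inverse B X" and X': "is_mat_mp_inverse B X'"
  shows "X = X'"
proof -
  note d = X[unfolded is_mat_mp_inverse_def] X'[unfolded is_mat_mp_inverse_def]
  have [simp]: "dim_row X = dim_col B" "dim_col X = dim_row B"
    "dim_row X' = dim_col B" "dim_col X' = dim_row B"
    using d by auto
  have BX: "B * X = B * X'"
  proof -
    have "B * X = (B * X') * (B * X)"
      using d by (simp flip: mat_mult_assoc)
    also have "\<dots> = mat_adjoint (B * X * (B * X'))"
      using d by (simp add: mat_adjoint_mult[of "B * X"])
    also have "B * X * (B * X') = B * X'"
      using d by (simp flip: mat_mult_assoc)
    finally show ?thesis using d by simp
  qed
  have XB: "X * B = X' * B"
  proof -
    have "X * B = (X * B) * (X' * B)"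
      using d by (simp add: mat_mult_assoc)
    also have "\<dots> = mat_adjoint (X' * B * (X * B))"
      using d by (simp add: mat_adjoint_mult[of "X' * B"])
    also have "X' * B * (X * B) = X' * B"
      using d by (simp add: mat_mult_assoc)
    finally show ?thesis using d by simp
  qed
  have "X = X * (B * X)" using d by (simp add: mat_mult_assoc)
  also have "\<dots> = X * B * X'" by (simp add: BX mat_mult_assoc)
  also have "\<dots> = X' * B * X'" by (simp add: XB)
  finally show ?thesis using d by simp
qed

section \<open>Invertibility of the cosine transform matrix\<close>

text \<open>
  Multiplication by \<open>2 * sin a\<close> makes the sum telescope, as
  \<open>2 * sin a * cos ((2 * k + 1) * a) = sin (2 * (k + 1) * a) - sin (2 * k * a)\<close>.
\<close>

lemma sum_cos_odd_multiples:
  fixes a :: real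
  shows "2 * sin a * (\<Sum>k<n. cos ((2 * real k + 1) * a)) = sin (2 * real n * a)"
proof (induction n)
  case (Suc n)
  have "2 * sin a * cos ((2 * real n + 1) * a) = sin (2 * real (Suc n) * a) - sin (2 * real n * a)"
    using sin_times_cos[of a "(2 * real n + 1) * a"] sin_minus[of "2 * real n * a"]
    by (simp add: algebra_simps)
  with Suc show ?case by (simp add: algebra_simps)
qed simp

text \<open>
  At \<open>a = m * pi / (2 * n)\<close> the telescoped sum is \<open>sin (m * pi) = 0\<close>, while \<open>sin a\<close> vanishes in the
  range \<open>\<bar>m\<bar> < 2 * n\<close> only for \<open>m = 0\<close>. The integer \<open>m\<close> stands for a sum or a difference of
  two row indices.
\<close>

lemma sum_cos_dct:
  fixes m :: int
  assumes m: "\<bar>m\<bar> < 2 * int n"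
  shows "(\<Sum>k<n. cos ((2 * real k + 1) * (of_int m * pi / (2 * real n)))) = (if m = 0 then real n else 0)"
proof (cases "m = 0")
  case False
  define a where "a = of_int m * pi / (2 * real n)"
  have n: "n > 0" using m by auto
  have "\<bar>of_int m :: real\<bar> < 2 * real n" using m by linarith
  hence "\<bar>a\<bar> < pi" 
    using n by (simp add: a_def abs_mult divide_less_eq mult.commute)
  moreover have "a \<noteq> 0" using n False by (simp add: a_def)
  ultimately have "sin a \<noteq> 0"
    using sin_eq_0_pi[of a] unfolding abs_less_iff by linarith
  moreover have "sin (2 * real n * a) = 0"
    using n by (simp add: a_def sin_integer_2pi sin_zero_iff_int2)
  ultimately show ?thesis
    using sum_cos_odd_multiples[of a n] False by (simp add: a_def)
qed simp

lemma dct_mat_carrier [simp, intro]: "dct_mat n \<in> carrier_mat n n"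
  by (simp add: dct_mat_def)

text \<open>
  The product-to-sum formula turns the inner product of rows \<open>i\<close> and \<open>j\<close> into the sums of
  \<open>sum_cos_dct\<close> for \<open>m = i - j\<close> and \<open>m = i + j\<close>. For \<open>i = j\<close> only the first of them survives,
  except for \<open>i = j = 0\<close>, where both do; the special scaling of row \<open>0\<close> compensates for this.
\<close>

lemma dct_mat_orthogonal: "dct_mat n * transpose_mat (dct_mat n) = 1\<^sub>m n"
proof (rule eq_matI)
  fix i j assume "i < dim_row (1\<^sub>m n :: complex mat)" "j < dim_col (1\<^sub>m n :: complex mat)"
  hence ij: "i < n" "j < n" by auto
  let ?c = "\<lambda>i. sqrt ((2 - (if i = 0 then 1 else 0)) / real n)"
  let ?x = "\<lambda>k. 2 * real k + 1"
  let ?a = "pi / (2 * real n)"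
  let ?p = "int i + int j" and ?m = "int i - int j"
  have "(dct_mat n * transpose_mat (dct_mat n)) $$ (i, j) =
    complex_of_real (\<Sum>k<n. (?c i * cos (real i * ?x k * pi / (2 * real n))) *
      (?c j * cos (real j * ?x k * pi / (2 * real n))))"
    using ij by (simp add: dct_mat_def scalar_prod_def atLeast0LessThan)
  also have "(\<Sum>k<n. (?c i * cos (real i * ?x k * pi / (2 * real n))) *
      (?c j * cos (real j * ?x k * pi / (2 * real n)))) =
      (\<Sum>k<n. ?c i * ?c j / 2 * (cos (?x k * (of_int ?m * ?a)) + cos (?x k * (of_int ?p * ?a))))"
  proof (rule sum.cong [OF refl])
    fix k
    have prod: "(c * cos x) * (d * cos y) = c * d / 2 * (cos (x - y) + cos (x + y))" for c d x y :: real
      by (simp add: cos_add cos_diff)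
    have arg: "real i * ?x k * pi / (2 * real n) - real j * ?x k * pi / (2 * real n) = ?x k * (of_int ?m * ?a)"
      "real i * ?x k * pi / (2 * real n) + real j * ?x k * pi / (2 * real n) = ?x k * (of_int ?p * ?a)"
      using ij by (simp_all add: field_simps)
    show "(?c i * cos (real i * ?x k * pi / (2 * real n))) * (?c j * cos (real j * ?x k * pi / (2 * real n))) =
      ?c i * ?c j / 2 * (cos (?x k * (of_int ?m * ?a)) + cos (?x k * (of_int ?p * ?a)))"
      unfolding prod arg ..
  qed
  also have "\<dots> = ?c i * ?c j / 2 * ((\<Sum>k<n. cos (?x k * (of_int ?m * pi / (2 * real n)))) +
      (\<Sum>k<n. cos (?x k * (of_int ?p * pi / (2 * real n)))))"
    unfolding sum_distrib_left[symmetric] sum.distrib by simp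
  also have "\<dots> = ?c i * ?c j / 2 * ((if ?m = 0 then real n else 0) + (if ?p = 0 then real n else 0))"
    using ij by (subst (1 2) sum_cos_dct) auto
  also have "\<dots> = (if i = j then 1 else 0)"
    using ij by auto
  finally show "(dct_mat n * transpose_mat (dct_mat n)) $$ (i, j) = 1\<^sub>m n $$ (i, j)"
    using ij by simp
qed (auto simp: dct_mat_def)

lemma det_dct_mat_nonzero: "det (dct_mat n) \<noteq> 0"
proof
  assume "det (dct_mat n) = 0"
  moreover have "det (dct_mat n) * det (transpose_mat (dct_mat n)) = 1"
    using dct_mat_orthogonal[of n] by (metis det_mult det_one dct_mat_carrier transpose_carrier_mat)
  ultimately show False by simp
qed

text \<open>
  The diagonal entries are positive multiples of \<open>cos (j * pi / (2 * n))\<close>, and the angle lies in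
  \<open>[0, pi / 2)\<close>.
\<close>

lemma det_W_mat_nonzero: "det (W_mat n) \<noteq> 0"
proof -
  have "det (W_mat n) = (\<Prod>j<n. W_mat n $$ (j, j))"
    by (subst det_upper_triangular[of _ n])
      (auto simp: W_mat_def mat_diag_def prod_list_diag_prod atLeast0LessThan intro!: upper_triangularI prod.cong)
  moreover have "W_mat n $$ (j, j) \<noteq> 0" if "j < n" for j
  proof -
    have "real j * pi / (2 * real n) < pi / 2"
      using that by (simp add: field_simps)
    moreover have "real j * pi / (2 * real n) \<ge> 0" by simp
    ultimately have "cos (real j * pi / (2 * real n)) > 0"
      by (intro cos_gt_zero_pi) (auto intro: less_le_trans[of _ 0])
    thus ?thesis using that by (auto simp: W_mat_def mat_diag_def dct_mat_def)
  qed
  ultimately show ?thesis by simp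
qed

lemma mat_inverse_nonzero_det:
  fixes A :: "'a :: field mat"
  assumes A: "A \<in> carrier_mat n n" and det: "det A \<noteq> 0"
  obtains B where "mat_inverse A = Some B" "B \<in> carrier_mat n n" "A * B = 1\<^sub>m n" "B * A = 1\<^sub>m n"
proof (cases "mat_inverse A")
  case None
  thus ?thesis
    using mat_inverse(1)[OF A, of "()"] det_non_zero_imp_unit[OF A det, of "()"] by simp
next
  case (Some B)
  thus ?thesis using mat_inverse(2)[OF A] that by blast
qed

lemma M_mat_carrier: "M_mat n \<in> carrier_mat n n"
  and det_M_mat_nonzero: "det (M_mat n) \<noteq> 0"
proof -
  have W: "W_mat n \<in> carrier_mat n n" by (simp add: W_mat_def)
  obtain V where V: "mat_inverse (W_mat n) = Some V" "V \<in> carrier_mat n n" "V * W_mat n = 1\<^sub>m n"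
    using mat_inverse_nonzero_det[OF W det_W_mat_nonzero] .
  have Z: "1\<^sub>m n + Z_mat n \<in> carrier_mat n n" by (simp add: Z_mat_def)
  have "det V * det (W_mat n) = 1"
    using arg_cong[OF V(3), of det] by (simp add: det_mult[OF V(2) W])
  hence dV: "det V \<noteq> 0" by auto
  have "det (1\<^sub>m n + Z_mat n) = (\<Prod>j<n. 1)"
    by (subst det_upper_triangular[OF _ Z])
      (auto simp: Z_mat_def prod_list_diag_prod atLeast0LessThan intro!: upper_triangularI prod.cong)
  hence dZ: "det (1\<^sub>m n + Z_mat n) = 1" by simp
  have M: "M_mat n = V * dct_mat n * (1\<^sub>m n + Z_mat n)"
    by (simp add: M_mat_def V)
  show "M_mat n \<in> carrier_mat n n"
    unfolding M using V(2) Z by (meson mult_carrier_mat dct_mat_carrier)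
  have VC: "V * dct_mat n \<in> carrier_mat n n" using V(2) by (meson mult_carrier_mat dct_mat_carrier)
  show "det (M_mat n) \<noteq> 0"
    unfolding M using dV dZ det_dct_mat_nonzero[of n]
    by (simp add: det_mult[OF VC Z] det_mult[OF V(2) dct_mat_carrier])
qed

section \<open>The tensor transform and its inverse\<close>

text \<open>
  The mode-3 product of a tensor with a matrix. Making the matrix a parameter, instead of taking
  \<open>M_mat\<close> as in \<open>L\<close>, lets the inverse of \<open>L\<close> be an instance of the same operation.
\<close>

definition mode3 :: "complex mat \<Rightarrow> tensor \<Rightarrow> tensor" where
  "mode3 N T = vec (dim3 T) (\<lambda>k. mat (dim1 T) (dim2 T)
     (\<lambda>(i, j). \<Sum>l<dim3 T. N $$ (k, l) * (T $ l) $$ (i, j)))"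

lemma L_eq_mode3: "L T = mode3 (M_mat (dim3 T)) T"
  by (simp add: L_def mode3_def)

lemma carrier_tensorD:
  assumes "T \<in> carrier_tensor n1 n2 n3"
  shows "dim3 T = n3" "dim_vec T = n3" "k < n3 \<Longrightarrow> T $ k \<in> carrier_mat n1 n2"
    "k < n3 \<Longrightarrow> dim_row (T $ k) = n1" "k < n3 \<Longrightarrow> dim_col (T $ k) = n2"
    "n3 > 0 \<Longrightarrow> dim1 T = n1" "n3 > 0 \<Longrightarrow> dim2 T = n2"
  using assms by (auto simp: carrier_tensor_def dim1_def dim2_def dim3_def)

text \<open>
  The dimensions \<open>dim1\<close> and \<open>dim2\<close> of a tensor without slices are arbitrary. This equation shows that
  carriers formed with them are nevertheless the intended ones.
\<close>

lemma carrier_tensor_0: "carrier_tensor n1 n2 0 = carrier_tensor m1 m2 0"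
  by (simp add: carrier_tensor_def)

lemma carrier_tensor_eqI:
  assumes "T \<in> carrier_tensor n1 n2 n3" "T' \<in> carrier_tensor n1 n2 n3"
    and "\<And>k. k < n3 \<Longrightarrow> T $ k = T' $ k"
  shows "T = T'"
  using assms by (intro eq_vecI) (auto simp: carrier_tensor_def)

lemma mode3_carrier:
  assumes "T \<in> carrier_tensor n1 n2 n3"
  shows "mode3 N T \<in> carrier_tensor n1 n2 n3"
  using carrier_tensorD[OF assms] by (auto simp: mode3_def carrier_tensor_def)

lemma index_mode3:
  assumes "T \<in> carrier_tensor n1 n2 n3" "k < n3" "i < n1" "j < n2"
  shows "(mode3 N T $ k) $$ (i, j) = (\<Sum>l<n3. N $$ (k, l) * (T $ l) $$ (i, j))"
  using carrier_tensorD[OF assms(1)] assms(2-) by (auto simp: mode3_def)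

lemma mode3_one:
  assumes T: "T \<in> carrier_tensor n1 n2 n3"
  shows "mode3 (1\<^sub>m n3) T = T"
proof (rule carrier_tensor_eqI[OF mode3_carrier[OF T] T], rule eq_matI)
  fix k i j assume k: "k < n3" and "i < dim_row (T $ k)" "j < dim_col (T $ k)"
  hence ij: "i < n1" "j < n2" using carrier_tensorD[OF T] by auto
  have "(mode3 (1\<^sub>m n3) T $ k) $$ (i, j) = (\<Sum>l<n3. if l = k then (T $ k) $$ (i, j) else 0)"
    unfolding index_mode3[OF T k ij] using k by (intro sum.cong) auto
  thus "(mode3 (1\<^sub>m n3) T $ k) $$ (i, j) = (T $ k) $$ (i, j)" using k by simp
qed (use carrier_tensorD[OF T] carrier_tensorD[OF mode3_carrier[OF T]] in auto)

lemma mode3_mult: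
  assumes T: "T \<in> carrier_tensor n1 n2 n3"
    and N: "N \<in> carrier_mat n3 n3" and N': "N' \<in> carrier_mat n3 n3"
  shows "mode3 N (mode3 N' T) = mode3 (N * N') T"
proof (rule carrier_tensor_eqI[OF mode3_carrier[OF mode3_carrier[OF T]] mode3_carrier[OF T]], rule eq_matI)
  fix k i j assume k: "k < n3"
    and "i < dim_row (mode3 (N * N') T $ k)" "j < dim_col (mode3 (N * N') T $ k)"
  hence ij: "i < n1" "j < n2" using carrier_tensorD[OF mode3_carrier[OF T]] by auto
  have "(mode3 N (mode3 N' T) $ k) $$ (i, j) =
      (\<Sum>l<n3. \<Sum>m<n3. N $$ (k, l) * N' $$ (l, m) * (T $ m) $$ (i, j))"
    unfolding index_mode3[OF mode3_carrier[OF T] k ij]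
    by (intro sum.cong) (auto simp: index_mode3[OF T _ ij] sum_distrib_left mult.assoc)
  also have "\<dots> = (\<Sum>m<n3. \<Sum>l<n3. N $$ (k, l) * N' $$ (l, m) * (T $ m) $$ (i, j))"
    by (rule sum.swap)
  also have "\<dots> = (\<Sum>m<n3. (N * N') $$ (k, m) * (T $ m) $$ (i, j))"
    using k N N' by (intro sum.cong) (auto simp: scalar_prod_def sum_distrib_right atLeast0LessThan)
  also have "\<dots> = (mode3 (N * N') T $ k) $$ (i, j)"
    by (rule index_mode3[OF T k ij, symmetric])
  finally show "(mode3 N (mode3 N' T) $ k) $$ (i, j) = (mode3 (N * N') T $ k) $$ (i, j)" .
qed (use carrier_tensorD[OF mode3_carrier[OF T]] carrier_tensorD[OF mode3_carrier[OF mode3_carrier[OF T]]] in auto)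

lemma L_carrier:
  "T \<in> carrier_tensor n1 n2 n3 \<Longrightarrow> L T \<in> carrier_tensor n1 n2 n3"
  by (simp add: L_eq_mode3 mode3_carrier)

lemmas L_slice_carrier = carrier_tensorD(3)[OF L_carrier]

lemma bij_betw_L: "bij_betw L (carrier_tensor n1 n2 n3) (carrier_tensor n1 n2 n3)"
proof -
  obtain N where N: "N \<in> carrier_mat n3 n3" "M_mat n3 * N = 1\<^sub>m n3" "N * M_mat n3 = 1\<^sub>m n3"
    using mat_inverse_nonzero_det[OF M_mat_carrier det_M_mat_nonzero] .
  have eq: "L T = mode3 (M_mat n3) T" if "T \<in> carrier_tensor n1 n2 n3" for T
    using carrier_tensorD(1)[OF that] by (simp add: L_eq_mode3)
  show ?thesis
    by (rule bij_betw_byWitness[where f' = "mode3 N"])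
      (auto simp: eq mode3_carrier mode3_mult[OF _ N(1) M_mat_carrier] mode3_mult[OF _ M_mat_carrier N(1)]
        N(2,3) mode3_one)
qed

lemma tensor_eqI_L:
  assumes T: "T \<in> carrier_tensor n1 n2 n3" and T': "T' \<in> carrier_tensor n1 n2 n3"
    and "\<And>k. k < n3 \<Longrightarrow> L T $ k = L T' $ k"
  shows "T = T'"
proof -
  have "L T = L T'"
    using assms(3) by (rule carrier_tensor_eqI[OF L_carrier[OF T] L_carrier[OF T']])
  thus ?thesis
    using bij_betw_imp_inj_on[OF bij_betw_L] T T' by (blast dest: inj_onD)
qed

text \<open>
  This turns a slicewise condition on \<open>L T\<close> into a definition of \<open>T\<close>; it gives sense to \<open>*\<^sub>c\<close>, \<open>\<^sup>H\<close>
  and \<open>\<^sup>\<dagger>\<close> alike.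
\<close>

lemma exists_tensor_with_L_slices:
  assumes "\<And>k. k < n3 \<Longrightarrow> F k \<in> carrier_mat n1 n2"
  shows "\<exists>!T. T \<in> carrier_tensor n1 n2 n3 \<and> (\<forall>k<n3. L T $ k = F k)"
proof -
  have "vec n3 F \<in> carrier_tensor n1 n2 n3"
    using assms by (simp add: carrier_tensor_def)
  hence "vec n3 F \<in> L ` carrier_tensor n1 n2 n3"
    unfolding bij_betw_imp_surj_on[OF bij_betw_L] .
  then obtain T where T: "T \<in> carrier_tensor n1 n2 n3" and "L T = vec n3 F"
    by (rule imageE) simp
  hence LT: "L T $ k = F k" if "k < n3" for k
    using that by simp
  show ?thesis
  proof (rule ex1I[of _ T])
    show "T \<in> carrier_tensor n1 n2 n3 \<and> (\<forall>k<n3. L T $ k = F k)"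
      using T LT by blast
  next
    fix T' assume "T' \<in> carrier_tensor n1 n2 n3 \<and> (\<forall>k<n3. L T' $ k = F k)"
    thus "T' = T"
      using tensor_eqI_L[OF _ T, of T'] LT by simp
  qed
qed

section \<open>Slicewise form of the tensor operations\<close>

lemma
  assumes A: "A \<in> carrier_tensor n1 m n3" and B: "B \<in> carrier_tensor m n2 n3"
  shows cprod_carrier: "A *\<^sub>c B \<in> carrier_tensor n1 n2 n3"
    and L_cprod: "k < n3 \<Longrightarrow> L (A *\<^sub>c B) $ k = L A $ k * L B $ k"
proof -
  have d: "dim3 A = n3" "carrier_tensor (dim1 A) (dim2 B) n3 = carrier_tensor n1 n2 n3"
    using carrier_tensorD[OF A] carrier_tensorD[OF B] by (cases "n3 = 0"; auto simp: carrier_tensor_0)+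
  have "\<exists>!T. T \<in> carrier_tensor n1 n2 n3 \<and> (\<forall>k<n3. L T $ k = L A $ k * L B $ k)"
    using A B by (intro exists_tensor_with_L_slices mult_carrier_mat L_slice_carrier)
  from theI'[OF this] show "A *\<^sub>c B \<in> carrier_tensor n1 n2 n3"
    "k < n3 \<Longrightarrow> L (A *\<^sub>c B) $ k = L A $ k * L B $ k"
    unfolding cprod_def d by auto
qed

lemma
  assumes A: "A \<in> carrier_tensor n1 n2 n3"
  shows ctranspose_carrier: "A\<^sup>H \<in> carrier_tensor n2 n1 n3"
    and L_ctranspose: "k < n3 \<Longrightarrow> L (A\<^sup>H) $ k = mat_adjoint (L A $ k)"
proof -
  have d: "dim3 A = n3" "carrier_tensor (dim2 A) (dim1 A) n3 = carrier_tensor n2 n1 n3"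
    using carrier_tensorD[OF A] by (cases "n3 = 0"; auto simp: carrier_tensor_0)+
  have "\<exists>!T. T \<in> carrier_tensor n2 n1 n3 \<and> (\<forall>k<n3. L T $ k = mat_adjoint (L A $ k))"
    using A by (intro exists_tensor_with_L_slices mat_adjoint_carrier L_slice_carrier)
  from theI'[OF this] show "A\<^sup>H \<in> carrier_tensor n2 n1 n3"
    "k < n3 \<Longrightarrow> L (A\<^sup>H) $ k = mat_adjoint (L A $ k)"
    unfolding ctranspose_def d by auto
qed

lemma tensor_eq_iff_L:
  assumes "T \<in> carrier_tensor n1 n2 n3" "T' \<in> carrier_tensor n1 n2 n3"
  shows "T = T' \<longleftrightarrow> (\<forall>k<n3. L T $ k = L T' $ k)"
  using tensor_eqI_L[OF assms] by auto

lemma is_mp_inverse_iff_slices: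
  assumes B: "B \<in> carrier_tensor n1 n2 n3"
  shows "is_mp_inverse B X \<longleftrightarrow>
    X \<in> carrier_tensor n2 n1 n3 \<and> (\<forall>k<n3. is_mat_mp_inverse (L B $ k) (L X $ k))"
proof -
  have d: "dim3 B = n3" "carrier_tensor (dim2 B) (dim1 B) n3 = carrier_tensor n2 n1 n3"
    using carrier_tensorD[OF B] by (cases "n3 = 0"; auto simp: carrier_tensor_0)+
  show ?thesis
  proof (cases "X \<in> carrier_tensor n2 n1 n3")
    case X: True
    note BX = cprod_carrier[OF B X] and XB = cprod_carrier[OF X B]
    have car: "L B $ k \<in> carrier_mat n1 n2" "L X $ k \<in> carrier_mat n2 n1" if "k < n3" for k
      using B X that by (auto intro: L_slice_carrier)
    hence dims: "dim_row (L B $ k) = n1" "dim_col (L B $ k) = n2" if "k < n3" for k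
      using that by auto
    show ?thesis
      unfolding is_mp_inverse_def d is_mat_mp_inverse_def
        tensor_eq_iff_L[OF cprod_carrier[OF BX B] B] tensor_eq_iff_L[OF cprod_carrier[OF XB X] X]
        tensor_eq_iff_L[OF ctranspose_carrier[OF BX] BX] tensor_eq_iff_L[OF ctranspose_carrier[OF XB] XB]
      using X car by (auto simp: dims L_cprod[OF BX B] L_cprod[OF XB X] L_ctranspose[OF BX] L_ctranspose[OF XB]
          L_cprod[OF B X] L_cprod[OF X B])
  qed (simp add: is_mp_inverse_def d)
qed

text \<open>
  Moore-Penrose inverses of the slices of \<open>L B\<close>, transported back through \<open>L\<close>.
\<close>

lemma mp_inverse_is_mp_inverse:
  assumes B: "B \<in> carrier_tensor n1 n2 n3"
  shows "is_mp_inverse B (B\<^sup>\<dagger>)"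
proof -
  define F where "F k = (SOME X. is_mat_mp_inverse (L B $ k) X)" for k
  have F: "is_mat_mp_inverse (L B $ k) (F k)" for k
    unfolding F_def by (rule someI_ex) (metis exists_mat_mp_inverse)
  have "F k \<in> carrier_mat n2 n1" if "k < n3" for k
    using F[of k] L_slice_carrier[OF B that] by (auto simp: is_mat_mp_inverse_def)
  then obtain X where X: "X \<in> carrier_tensor n2 n1 n3" "\<forall>k<n3. L X $ k = F k"
    using exists_tensor_with_L_slices[of n3 F n2 n1] by blast
  hence "is_mp_inverse B X"
    using F by (simp add: is_mp_inverse_iff_slices[OF B])
  moreover have "X' = X" if "is_mp_inverse B X'" for X'
    using that X F by (intro tensor_eqI_L[of _ n2 n1 n3])
      (auto simp: is_mp_inverse_iff_slices[OF B] intro: mat_mp_inverse_unique)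
  ultimately show ?thesis
    unfolding mp_inverse_def by (rule theI)
qed

lemma cprod_assoc:
  assumes A: "A \<in> carrier_tensor n1 m1 n3" and B: "B \<in> carrier_tensor m1 m2 n3"
    and C: "C \<in> carrier_tensor m2 n2 n3"
  shows "A *\<^sub>c B *\<^sub>c C = A *\<^sub>c (B *\<^sub>c C)"
proof (rule tensor_eqI_L)
  note AB = cprod_carrier[OF A B] and BC = cprod_carrier[OF B C]
  show "A *\<^sub>c B *\<^sub>c C \<in> carrier_tensor n1 n2 n3" by (rule cprod_carrier[OF AB C])
  show "A *\<^sub>c (B *\<^sub>c C) \<in> carrier_tensor n1 n2 n3" by (rule cprod_carrier[OF A BC])
  show "L (A *\<^sub>c B *\<^sub>c C) $ k = L (A *\<^sub>c (B *\<^sub>c C)) $ k" if "k < n3" for k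
    using that assoc_mult_mat[OF L_slice_carrier[OF A] L_slice_carrier[OF B] L_slice_carrier[OF C]]
    by (simp add: L_cprod[OF AB C] L_cprod[OF A BC] L_cprod[OF A B] L_cprod[OF B C])
qed

lemma ctranspose_cprod:
  assumes A: "A \<in> carrier_tensor n1 m n3" and B: "B \<in> carrier_tensor m n2 n3"
  shows "(A *\<^sub>c B)\<^sup>H = B\<^sup>H *\<^sub>c A\<^sup>H"
proof (rule tensor_eqI_L)
  note AB = cprod_carrier[OF A B] and A' = ctranspose_carrier[OF A] and B' = ctranspose_carrier[OF B]
  show "(A *\<^sub>c B)\<^sup>H \<in> carrier_tensor n2 n1 n3" by (rule ctranspose_carrier[OF AB])
  show "B\<^sup>H *\<^sub>c A\<^sup>H \<in> carrier_tensor n2 n1 n3" by (rule cprod_carrier[OF B' A'])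
  show "L ((A *\<^sub>c B)\<^sup>H) $ k = L (B\<^sup>H *\<^sub>c A\<^sup>H) $ k" if k: "k < n3" for k
    using k carrier_matD[OF L_slice_carrier[OF A k]] carrier_matD[OF L_slice_carrier[OF B k]]
    by (simp add: L_ctranspose[OF AB] L_cprod[OF B' A'] L_cprod[OF A B] L_ctranspose[OF A]
        L_ctranspose[OF B] mat_adjoint_mult)
qed

lemma ctranspose_ctranspose:
  assumes A: "A \<in> carrier_tensor n1 n2 n3"
  shows "(A\<^sup>H)\<^sup>H = A"
  by (rule tensor_eqI_L[OF ctranspose_carrier[OF ctranspose_carrier[OF A]] A])
    (simp add: L_ctranspose[OF ctranspose_carrier[OF A]] L_ctranspose[OF A])

section \<open>The inverse along a tensor\<close>

text \<open>
  The conjugate transpose of the condition \<open>X\<^sup>H = G\<^sup>H *\<^sub>c W\<close> is \<open>X = W\<^sup>H *\<^sub>c G\<close>, so \<open>V = W\<^sup>H\<close>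
  exhibits \<open>X\<close> as a left multiple of \<open>G\<close>.
\<close>

lemma is_inverse_alongE:
  assumes A: "A \<in> carrier_tensor n1 n2 n3" and G: "G \<in> carrier_tensor n2 n1 n3"
    and X: "is_inverse_along A G X"
  obtains U V where "X \<in> carrier_tensor n2 n1 n3" "U \<in> carrier_tensor n1 n1 n3"
    "V \<in> carrier_tensor n2 n2 n3" "X *\<^sub>c A *\<^sub>c G = G" "G *\<^sub>c A *\<^sub>c X = G"
    "X = G *\<^sub>c U" "X = V *\<^sub>c G"
proof -
  have d: "dim3 A = n3" "carrier_tensor (dim2 A) (dim1 A) n3 = carrier_tensor n2 n1 n3"
    "carrier_tensor (dim1 A) (dim1 A) n3 = carrier_tensor n1 n1 n3"
    "carrier_tensor (dim2 A) (dim2 A) n3 = carrier_tensor n2 n2 n3"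
    using carrier_tensorD[OF A] by (cases "n3 = 0"; auto simp: carrier_tensor_0)+
  obtain U V where *: "X \<in> carrier_tensor n2 n1 n3" "U \<in> carrier_tensor n1 n1 n3"
    "V \<in> carrier_tensor n2 n2 n3" "X *\<^sub>c A *\<^sub>c G = G" "G *\<^sub>c A *\<^sub>c X = G"
    "X = G *\<^sub>c U" "X\<^sup>H = G\<^sup>H *\<^sub>c V"
    using X unfolding is_inverse_along_def d by blast
  have "X = V\<^sup>H *\<^sub>c G"
    using arg_cong[OF *(7), of ctranspose]
    by (simp add: ctranspose_ctranspose[OF *(1)] ctranspose_ctranspose[OF G]
        ctranspose_cprod[OF ctranspose_carrier[OF G] *(3)])
  with * show ?thesis
    using that[of U "V\<^sup>H"] ctranspose_carrier[OF *(3)] by blast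
qed

text \<open>
  Both tensors equal \<open>X *\<^sub>c A *\<^sub>c X'\<close>: \<open>X\<close> because it is a left multiple of \<open>G = G *\<^sub>c A *\<^sub>c X'\<close>, and
  \<open>X'\<close> because it is a right multiple of \<open>G = X *\<^sub>c A *\<^sub>c G\<close>.
\<close>

lemma inverse_along_unique:
  assumes A: "A \<in> carrier_tensor n1 n2 n3" and G: "G \<in> carrier_tensor n2 n1 n3"
    and X: "is_inverse_along A G X" and X': "is_inverse_along A G X'"
  shows "X = X'"
proof -
  obtain U V where 1: "X \<in> carrier_tensor n2 n1 n3" "V \<in> carrier_tensor n2 n2 n3"
    "X *\<^sub>c A *\<^sub>c G = G" "X = V *\<^sub>c G"
    using is_inverse_alongE[OF A G X] by metis
  obtain U' where 2: "X' \<in> carrier_tensor n2 n1 n3" "U' \<in> carrier_tensor n1 n1 n3"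
    "G *\<^sub>c A *\<^sub>c X' = G" "X' = G *\<^sub>c U'"
    using is_inverse_alongE[OF A G X'] by metis
  note GA = cprod_carrier[OF G A] and XA = cprod_carrier[OF 1(1) A]
  have "X = V *\<^sub>c (G *\<^sub>c A *\<^sub>c X')" using 1 2 by simp
  also have "\<dots> = V *\<^sub>c (G *\<^sub>c A) *\<^sub>c X'"
    by (rule cprod_assoc[OF 1(2) GA 2(1), symmetric])
  also have "V *\<^sub>c (G *\<^sub>c A) = X *\<^sub>c A"
    unfolding 1(4) by (rule cprod_assoc[OF 1(2) G A, symmetric])
  also have "X *\<^sub>c A *\<^sub>c X' = X *\<^sub>c A *\<^sub>c G *\<^sub>c U'"
    unfolding 2(4) by (rule cprod_assoc[OF XA G 2(2), symmetric])
  also have "\<dots> = X'" using 1 2 by simp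
  finally show ?thesis .
qed

theorem theorem5p2:
  fixes n1 n2 n3 :: nat and A G :: tensor
  assumes "A \<in> carrier_tensor n1 n2 n3"
    and "G \<in> carrier_tensor n2 n1 n3"
    and "invertible_along A G"
  shows "A \<parallel>\<^sub>c G = G *\<^sub>c (G *\<^sub>c A *\<^sub>c G)\<^sup>\<dagger> *\<^sub>c G"
proof -
  note A = assms(1) and G = assms(2)
  define B where "B = G *\<^sub>c A *\<^sub>c G"
  define P where "P = B\<^sup>\<dagger>"
  obtain X where X_along: "is_inverse_along A G X"
    using assms(3) by (auto simp: invertible_along_def)
  obtain U V where X: "X \<in> carrier_tensor n2 n1 n3" and U: "U \<in> carrier_tensor n1 n1 n3"
    and V: "V \<in> carrier_tensor n2 n2 n3" and XAG: "X *\<^sub>c A *\<^sub>c G = G" and GAX: "G *\<^sub>c A *\<^sub>c X = G"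
    and XU: "X = G *\<^sub>c U" and XV: "X = V *\<^sub>c G"
    using is_inverse_alongE[OF A G X_along] .
  note GA = cprod_carrier[OF G A]
  have B: "B \<in> carrier_tensor n2 n1 n3"
    unfolding B_def by (rule cprod_carrier[OF GA G])
  have P: "P \<in> carrier_tensor n1 n2 n3" and BPB: "B *\<^sub>c P *\<^sub>c B = B"
    using mp_inverse_is_mp_inverse[OF B] is_mp_inverse_iff_slices[OF B]
    by (auto simp: P_def is_mp_inverse_def)
  have VB: "V *\<^sub>c B = G"
    using XAG by (simp add: B_def XV cprod_assoc[OF V G A] cprod_assoc[OF V GA G])
  have BU: "B *\<^sub>c U = G"
    using GAX by (simp add: B_def XU cprod_assoc[OF GA G U])
  note BP = cprod_carrier[OF B P]
  have "G *\<^sub>c P *\<^sub>c G = V *\<^sub>c B *\<^sub>c P *\<^sub>c (B *\<^sub>c U)"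
    by (simp only: VB BU)
  also have "\<dots> = V *\<^sub>c (B *\<^sub>c P *\<^sub>c B) *\<^sub>c U"
    by (simp only: cprod_assoc[OF V B P] cprod_assoc[OF V BP cprod_carrier[OF B U]]
        cprod_assoc[OF BP B U, symmetric] cprod_assoc[OF V cprod_carrier[OF BP B] U])
  also have "\<dots> = X"
    by (simp only: BPB VB XU)
  finally have "X = G *\<^sub>c P *\<^sub>c G" ..
  moreover have "A \<parallel>\<^sub>c G = X"
    unfolding inverse_along_def
    using X_along inverse_along_unique[OF A G] by (intro the_equality) blast+
  ultimately show ?thesis by (simp add: P_def B_def)
qed

end
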